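(* Let $\mathfrak g$ be a Lie algebra over a field $\mathbb K$, let $$0\to V_1\to V_2\xrightarrow{p} V_3\to 0\qquad (A)$$ be a short exact sequence of $\mathfrak g$-modules (regarded as a short exact sequence of abelian Lie algebras), and let $$0\to V_3\xrightarrow{j} \mathfrak e\to\mathfrak g\to 0\qquad (B)$$ be an abelian extension of $\mathfrak g$ by the $\mathfrak g$-module $V_3$. Then the Yoneda product of (A) and (B), that is, the map $\mu=j\circ p:V_2\to\mathfrak e$ with $\mathfrak e$ acting on $V_2$ through the projection $\mathfrak e\to\mathfrak g$ and the $\mathfrak g$-module structure of $V_2$, is a crossed module of Lie algebras (with kernel $V_1$ and cokernel $\mathfrak g$). Its associated $3$-cocycle is cohomologous to the image of the $2$-cocycle defining the abelian extension (B) under the connecting homomorphism $\partial:H^2(\mathfrak g,V_3)\to H^3(\mathfrak g,V_1)$ of the long exact cohomology sequence associated to (A).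
   Context: A crossed module of Lie algebras is a Lie algebra homomorphism $\mu:\mathfrak m\to\mathfrak n$ together with an action of $\mathfrak n$ on $\mathfrak m$ by derivations such that (a) $\mu(n\cdot m)=[n,\mu(m)]$ for all $n\in\mathfrak n,m\in\mathfrak m$, and (b) $\mu(m)\cdot m'=[m,m']$ for all $m,m'\in\mathfrak m$. An abelian extension of $\mathfrak g$ by the $\mathfrak g$-module $V_3$ is a short exact sequence of Lie algebras with $V_3$ an abelian ideal such that the induced $\mathfrak g$-action on $V_3$ is the given one; up to equivalence $\mathfrak e=V_3\times_\alpha\mathfrak g$, i.e. $V_3\oplus\mathfrak g$ with bracket $[(v,x),(w,y)]=(x\cdot w-y\cdot v+\alpha(x,y),[x,y])$ for a $2$-cocycle $\alpha\in Z^2(\mathfrak g,V_3)$. The $3$-cocycle associated to a crossed module with $V=\ker\mu$, $\mathfrak g=\operatorname{coker}\mu$, inclusion $i:V\to\mathfrak m$ and projection $\pi:\mathfrak n\to\mathfrak g$: choose a linear section $\rho$ of $\pi$ and a skew-symmetric bilinear $\beta:\mathfrak g\times\mathfrak g\to\mathfrak m$ with $\mu(\beta(x,y))=[\rho(x),\rho(y)]-\rho([x,y])$; the formal Chevalley–Eilenberg coboundary of $\beta$ (with $x$ acting on $\mathfrak m$ through $\rho(x)$) takes values in $i(V)$ and yields a $3$-cocycle $\gamma$ of $\mathfrak g$ with values in $V$, whose class in $H^3(\mathfrak g,V)$ is independent of the choices. *)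

theory Defs
  imports "HOL-Analysis.Product_Vector"
begin

section \<open>Lie algebras and their modules\<close>

locale lie_algebra = vector_space scale
  for scale :: "'k::field \<Rightarrow> 'g::ab_group_add \<Rightarrow> 'g" +
  fixes bracket :: "'g \<Rightarrow> 'g \<Rightarrow> 'g"
  assumes bracket_linear_left: "Vector_Spaces.linear scale scale (\<lambda>x. bracket x y)"
    and bracket_linear_right: "Vector_Spaces.linear scale scale (bracket x)"
    and bracket_self: "bracket x x = 0"
    and jacobi: "bracket x (bracket y z) + bracket y (bracket z x) + bracket z (bracket x y) = 0"

locale lie_hom = dom: lie_algebra s1 br1 + cod: lie_algebra s2 br2
  for s1 :: "'k::field \<Rightarrow> 'a::ab_group_add \<Rightarrow> 'a" and br1
    and s2 :: "'k \<Rightarrow> 'b::ab_group_add \<Rightarrow> 'b" and br2 +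
  fixes f :: "'a \<Rightarrow> 'b"
  assumes linear: "Vector_Spaces.linear s1 s2 f"
    and hom: "f (br1 x y) = br2 (f x) (f y)"

locale lie_module = L: lie_algebra sg brg + V: vector_space sV
  for sg :: "'k::field \<Rightarrow> 'g::ab_group_add \<Rightarrow> 'g" and brg
    and sV :: "'k \<Rightarrow> 'v::ab_group_add \<Rightarrow> 'v" +
  fixes act :: "'g \<Rightarrow> 'v \<Rightarrow> 'v"
  assumes act_linear_left: "Vector_Spaces.linear sg sV (\<lambda>x. act x v)"
    and act_linear_right: "Vector_Spaces.linear sV sV (act x)"
    and act_bracket: "act (brg x y) v = act x (act y v) - act y (act x v)"

locale lie_module_hom = dom: lie_module sg brg sV actV + cod: lie_module sg brg sW actW
  for sg :: "'k::field \<Rightarrow> 'g::ab_group_add \<Rightarrow> 'g" and brg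
    and sV :: "'k \<Rightarrow> 'v::ab_group_add \<Rightarrow> 'v" and actV
    and sW :: "'k \<Rightarrow> 'w::ab_group_add \<Rightarrow> 'w" and actW +
  fixes f :: "'v \<Rightarrow> 'w"
  assumes linear: "Vector_Spaces.linear sV sW f"
    and equivariant: "f (actV x v) = actW x (f v)"

definition short_exact :: "('a \<Rightarrow> 'b) \<Rightarrow> ('b \<Rightarrow> 'c::zero) \<Rightarrow> bool" where
  "short_exact f g \<longleftrightarrow> inj f \<and> range f = {y. g y = 0} \<and> surj g"

locale short_exact_modules =
  incl: lie_module_hom sg brg s1 act1 s2 act2 i +
  proj: lie_module_hom sg brg s2 act2 s3 act3 p
  for sg :: "'k::field \<Rightarrow> 'g::ab_group_add \<Rightarrow> 'g" and brg
    and s1 :: "'k \<Rightarrow> 'v1::ab_group_add \<Rightarrow> 'v1" and act1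
    and s2 :: "'k \<Rightarrow> 'v2::ab_group_add \<Rightarrow> 'v2" and act2
    and s3 :: "'k \<Rightarrow> 'v3::ab_group_add \<Rightarrow> 'v3" and act3
    and i :: "'v1 \<Rightarrow> 'v2" and p :: "'v2 \<Rightarrow> 'v3" +
  assumes exact: "short_exact i p"


section \<open>Chevalley--Eilenberg cohomology\<close>

text \<open>
  An \<open>n\<close>-cochain is an alternating \<open>n\<close>-linear map. It is encoded as a function on lists which is
  relevant only on lists of length \<open>n\<close> and is set to \<open>0\<close> elsewhere, so that equal cochains are
  equal functions. ``Alternating'' means vanishing on lists with a repeated entry, which is the
  correct notion in every characteristic.
\<close>

definition cochains ::
    "('k::field \<Rightarrow> 'g::ab_group_add \<Rightarrow> 'g) \<Rightarrow> ('k \<Rightarrow> 'v::ab_group_add \<Rightarrow> 'v) \<Rightarrow> nat \<Rightarrow> ('g list \<Rightarrow> 'v) set"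
  where "cochains sg sV n = {f.
     (\<forall>xs. length xs \<noteq> n \<longrightarrow> f xs = 0) \<and>
     (\<forall>xs k. length xs = n \<longrightarrow> k < n \<longrightarrow> Vector_Spaces.linear sg sV (\<lambda>x. f (xs[k := x]))) \<and>
     (\<forall>xs. length xs = n \<longrightarrow> \<not> distinct xs \<longrightarrow> f xs = 0)}"

definition omit :: "nat \<Rightarrow> 'a list \<Rightarrow> 'a list" where
  "omit k xs = take k xs @ drop (Suc k) xs"

text \<open>
  The map \<open>act\<close> is not required to be a Lie algebra action: the same formula provides the formal
  coboundary that enters the cocycle of a crossed module.
\<close>

definition ce_d ::
    "('g \<Rightarrow> 'g \<Rightarrow> 'g) \<Rightarrow> ('k::field \<Rightarrow> 'v::ab_group_add \<Rightarrow> 'v) \<Rightarrow> ('g \<Rightarrow> 'v \<Rightarrow> 'v) \<Rightarrow> nat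
      \<Rightarrow> ('g list \<Rightarrow> 'v) \<Rightarrow> 'g list \<Rightarrow> 'v"
  where "ce_d brg sV act n f xs =
    (if length xs = Suc n then
       (\<Sum>k\<le>n. sV ((-1) ^ k) (act (xs ! k) (f (omit k xs)))) +
       (\<Sum>l\<le>n. \<Sum>k<l. sV ((-1) ^ (k + l)) (f (brg (xs ! k) (xs ! l) # omit k (omit l xs))))
     else 0)"

lemma ce_d_1:
  assumes "vector_space sV"
  shows "ce_d brg sV act 1 f [x, y] = act x (f [y]) - act y (f [x]) - f [brg x y]"
proof -
  interpret vector_space sV by fact
  show ?thesis
    by (simp add: ce_d_def omit_def numeral_2_eq_2 lessThan_Suc atMost_Suc algebra_simps)
qed

lemma ce_d_2:
  assumes "vector_space sV"
  shows "ce_d brg sV act 2 f [x, y, z] =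
    act x (f [y, z]) - act y (f [x, z]) + act z (f [x, y])
    - f [brg x y, z] + f [brg x z, y] - f [brg y z, x]"
proof -
  interpret vector_space sV by fact
  show ?thesis
    by (simp add: ce_d_def omit_def numeral_2_eq_2 numeral_3_eq_3 lessThan_Suc atMost_Suc algebra_simps)
qed

definition cocycles where
  "cocycles sg brg sV act n =
    {f \<in> cochains sg sV n. ce_d brg sV act n f = (\<lambda>_. 0)}"

definition coboundaries where
  "coboundaries sg brg sV act n =
    (case n of 0 \<Rightarrow> {\<lambda>_. 0} | Suc m \<Rightarrow> ce_d brg sV act m ` cochains sg sV m)"

definition cohomologous where
  "cohomologous sg brg sV act n =
    {(f, g). f \<in> cocycles sg brg sV act n \<and> g \<in> cocycles sg brg sV act n \<and>
       (\<lambda>xs. f xs - g xs) \<in> coboundaries sg brg sV act n}"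

definition cohomology where
  "cohomology sg brg sV act n = cocycles sg brg sV act n // cohomologous sg brg sV act n"

definition cohomology_class where
  "cohomology_class sg brg sV act n f = cohomologous sg brg sV act n `` {f}"

text \<open>
  The connecting map sends a class \<open>c\<close> in \<open>H\<^sup>n(\<gg>, V\<^sub>3)\<close> to the set of all cocycles obtained by
  choosing a cocycle in \<open>c\<close>, lifting it to a cochain \<open>b\<close> with values in \<open>V\<^sub>2\<close>, and pulling the
  coboundary of \<open>b\<close> back along \<open>i\<close>. By the usual diagram chase this set of all possible outcomes
  is exactly one class in \<open>H\<^sup>n\<^sup>+\<^sup>1(\<gg>, V\<^sub>1)\<close>.
\<close>

definition connecting_hom ::
    "('k::field \<Rightarrow> 'g::ab_group_add \<Rightarrow> 'g) \<Rightarrow> ('g \<Rightarrow> 'g \<Rightarrow> 'g)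
      \<Rightarrow> ('k \<Rightarrow> 'v1::ab_group_add \<Rightarrow> 'v1) \<Rightarrow> ('g \<Rightarrow> 'v1 \<Rightarrow> 'v1)
      \<Rightarrow> ('k \<Rightarrow> 'v2::ab_group_add \<Rightarrow> 'v2) \<Rightarrow> ('g \<Rightarrow> 'v2 \<Rightarrow> 'v2)
      \<Rightarrow> ('v1 \<Rightarrow> 'v2) \<Rightarrow> ('v2 \<Rightarrow> 'v3) \<Rightarrow> nat \<Rightarrow> ('g list \<Rightarrow> 'v3) set \<Rightarrow> ('g list \<Rightarrow> 'v1) set"
  where "connecting_hom sg brg s1 act1 s2 act2 i p n c =
    {g \<in> cocycles sg brg s1 act1 (Suc n).
       \<exists>b \<in> cochains sg s2 n. p \<circ> b \<in> c \<and> i \<circ> g = ce_d brg s2 act2 n b}"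


section \<open>Abelian extensions\<close>

text \<open>
  That the range of \<open>j\<close> is an abelian ideal follows from \<open>j\<close> being a homomorphism for the zero
  bracket and from exactness.
\<close>

locale abelian_extension =
  module: lie_module sg brg sV act +
  incl: lie_hom sV "\<lambda>_ _. 0" se bre j +
  proj: lie_hom se bre sg brg q
  for sg :: "'k::field \<Rightarrow> 'g::ab_group_add \<Rightarrow> 'g" and brg
    and sV :: "'k \<Rightarrow> 'v::ab_group_add \<Rightarrow> 'v" and act
    and se :: "'k \<Rightarrow> 'e::ab_group_add \<Rightarrow> 'e" and bre
    and j :: "'v \<Rightarrow> 'e" and q :: "'e \<Rightarrow> 'g" +
  assumes exact: "short_exact j q"
    and induced_action: "bre e (j v) = j (act (q e) v)"

definition twisted_bracket ::
    "('g \<Rightarrow> 'g \<Rightarrow> 'g) \<Rightarrow> ('g \<Rightarrow> 'v::ab_group_add \<Rightarrow> 'v) \<Rightarrow> ('g list \<Rightarrow> 'v)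
      \<Rightarrow> 'v \<times> 'g \<Rightarrow> 'v \<times> 'g \<Rightarrow> 'v \<times> 'g"
  where "twisted_bracket brg act \<alpha> = (\<lambda>(v, x) (w, y). (act x w - act y v + \<alpha> [x, y], brg x y))"

text \<open>The cocycle \<open>\<alpha>\<close> defines an extension which is equivalent to \<open>V \<times>\<^sub>\<alpha> \<gg>\<close>.\<close>

definition defining_cocycle ::
    "('k::field \<Rightarrow> 'g::ab_group_add \<Rightarrow> 'g) \<Rightarrow> ('g \<Rightarrow> 'g \<Rightarrow> 'g)
      \<Rightarrow> ('k \<Rightarrow> 'v::ab_group_add \<Rightarrow> 'v) \<Rightarrow> ('g \<Rightarrow> 'v \<Rightarrow> 'v)
      \<Rightarrow> ('k \<Rightarrow> 'e::ab_group_add \<Rightarrow> 'e) \<Rightarrow> ('e \<Rightarrow> 'e \<Rightarrow> 'e)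
      \<Rightarrow> ('v \<Rightarrow> 'e) \<Rightarrow> ('e \<Rightarrow> 'g) \<Rightarrow> ('g list \<Rightarrow> 'v) \<Rightarrow> bool"
  where "defining_cocycle sg brg sV act se bre j q \<alpha> \<longleftrightarrow>
    \<alpha> \<in> cocycles sg brg sV act 2 \<and>
    (\<exists>\<phi>. lie_hom (module_prod.scale sV sg) (twisted_bracket brg act \<alpha>) se bre \<phi> \<and> bij \<phi> \<and>
         (\<forall>v. \<phi> (v, 0) = j v) \<and> (\<forall>v x. q (\<phi> (v, x)) = x))"


section \<open>Crossed modules\<close>

locale crossed_module =
  hom: lie_hom sm brm sn brn \<mu> + action: lie_module sn brn sm act
  for sm :: "'k::field \<Rightarrow> 'm::ab_group_add \<Rightarrow> 'm" and brm
    and sn :: "'k \<Rightarrow> 'n::ab_group_add \<Rightarrow> 'n" and brn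
    and \<mu> :: "'m \<Rightarrow> 'n" and act :: "'n \<Rightarrow> 'm \<Rightarrow> 'm" +
  assumes derivation: "act n (brm m m') = brm (act n m) m' + brm m (act n m')"
    and equivariance: "\<mu> (act n m) = brn n (\<mu> m)"
    and peiffer: "act (\<mu> m) m' = brm m m'"

text \<open>
  A crossed module together with identifications \<open>V = ker \<mu>\<close> (via \<open>i\<close>, as modules over the cokernel,
  which acts on the kernel through arbitrary lifts) and \<open>\<gg> = coker \<mu>\<close> (via \<open>\<pi>\<close>).
\<close>

locale crossed_module_ker_coker =
  crossed_module sm brm sn brn \<mu> act +
  ker: lie_module sg brg sV actV +
  coker: lie_hom sn brn sg brg \<pi>
  for sg :: "'k::field \<Rightarrow> 'g::ab_group_add \<Rightarrow> 'g" and brg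
    and sV :: "'k \<Rightarrow> 'v::ab_group_add \<Rightarrow> 'v" and actV
    and sm :: "'k \<Rightarrow> 'm::ab_group_add \<Rightarrow> 'm" and brm
    and sn :: "'k \<Rightarrow> 'n::ab_group_add \<Rightarrow> 'n" and brn
    and i :: "'v \<Rightarrow> 'm" and \<mu> :: "'m \<Rightarrow> 'n" and \<pi> :: "'n \<Rightarrow> 'g"
    and act :: "'n \<Rightarrow> 'm \<Rightarrow> 'm" +
  assumes i_linear: "Vector_Spaces.linear sV sm i"
    and i_inj: "inj i"
    and i_range: "range i = {m. \<mu> m = 0}"
    and \<pi>_kernel: "{n. \<pi> n = 0} = range \<mu>"
    and \<pi>_surj: "surj \<pi>"
    and i_equivariant: "i (actV (\<pi> n) v) = act n (i v)"

definition associated_cocycle ::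
    "('k::field \<Rightarrow> 'g::ab_group_add \<Rightarrow> 'g) \<Rightarrow> ('g \<Rightarrow> 'g \<Rightarrow> 'g)
      \<Rightarrow> ('k \<Rightarrow> 'm::ab_group_add \<Rightarrow> 'm)
      \<Rightarrow> ('k \<Rightarrow> 'n::ab_group_add \<Rightarrow> 'n) \<Rightarrow> ('n \<Rightarrow> 'n \<Rightarrow> 'n)
      \<Rightarrow> ('v \<Rightarrow> 'm) \<Rightarrow> ('m \<Rightarrow> 'n) \<Rightarrow> ('n \<Rightarrow> 'g) \<Rightarrow> ('n \<Rightarrow> 'm \<Rightarrow> 'm)
      \<Rightarrow> ('g list \<Rightarrow> 'v) \<Rightarrow> bool"
  where "associated_cocycle sg brg sm sn brn i \<mu> \<pi> act \<gamma> \<longleftrightarrow>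
    (\<exists>\<rho> \<beta>. Vector_Spaces.linear sg sn \<rho> \<and> (\<forall>x. \<pi> (\<rho> x) = x) \<and>
       \<beta> \<in> cochains sg sm 2 \<and>
       (\<forall>x y. \<mu> (\<beta> [x, y]) = brn (\<rho> x) (\<rho> y) - \<rho> (brg x y)) \<and>
       i \<circ> \<gamma> = ce_d brg sm (\<lambda>x. act (\<rho> x)) 2 \<beta>)"

end

theory Submission
  imports Defs
begin

text \<open>
  Let \<open>\<rho>\<close> be a linear section of \<open>\<ee> \<rightarrow> \<gg>\<close> and \<open>\<beta>\<close> a cochain with values in \<open>V\<^sub>2\<close> as in the definition of the
  cocycle \<open>\<gamma>\<close> of the crossed module. As \<open>\<rho>(x)\<close> acts on \<open>V\<^sub>2\<close> as \<open>x\<close> does, the formal coboundary of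
  \<open>\<beta>\<close> is its true coboundary, and \<open>j(p(\<beta>(x, y))) = [\<rho>(x), \<rho>(y)] - \<rho>([x, y])\<close> says that \<open>p \<circ> \<beta>\<close> is the
  cocycle of the extension with respect to \<open>\<rho>\<close>. It differs from any other cocycle defining the
  extension by the coboundary of the difference of the two sections. So \<open>\<gamma>\<close> is obtained by lifting
  a defining cocycle, up to a coboundary, to \<open>\<beta>\<close> and pulling \<open>d\<beta>\<close> back to \<open>V\<^sub>1\<close>, which is the
  recipe for the connecting homomorphism.
\<close>

section \<open>Linear maps\<close>

lemma linear_section:
  assumes f: "Vector_Spaces.linear s1 s2 f" and "surj f"
  obtains g where "Vector_Spaces.linear s2 s1 g" "\<And>x. f (g x) = x"
proof -
  interpret f: Vector_Spaces.linear s1 s2 f by fact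
  interpret vector_space_pair s1 s2 by unfold_locales
  show thesis
    using linear_surjective_right_inverse[OF assms] that by (metis comp_apply id_apply)
qed

text \<open>Preimages under an injective linear map that are chosen point by point inherit
  linearity, because each identity can be tested after applying \<open>h\<close>.\<close>

lemma linear_cancel_inj:
  assumes h: "Vector_Spaces.linear s2 s3 h" and "inj h"
    and "Vector_Spaces.linear s1 s3 (\<lambda>x. h (f x))"
  shows "Vector_Spaces.linear s1 s2 f"
  using assms by (auto simp: Vector_Spaces.linear_iff inj_def)

lemma linear_comp:
  assumes "Vector_Spaces.linear s1 s2 f" and "Vector_Spaces.linear s2 s3 h"
  shows "Vector_Spaces.linear s1 s3 (\<lambda>x. h (f x))"
  using Vector_Spaces.linear_compose[OF assms] by (simp add: comp_def)

context
  fixes s1 :: "'k::field \<Rightarrow> 'a::ab_group_add \<Rightarrow> 'a"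
    and s2 :: "'k \<Rightarrow> 'b::ab_group_add \<Rightarrow> 'b" and f :: "'a \<Rightarrow> 'b"
  assumes f: "Vector_Spaces.linear s1 s2 f"
begin

text \<open>Linearity is the single premise of each fact, so one \<open>OF\<close> yields all
  rewrite rules for a concrete map.\<close>

lemmas linear_simps =
  module_hom.add[OF module_hom_linearI[OF f]]
  module_hom.diff[OF module_hom_linearI[OF f]]
  module_hom.neg[OF module_hom_linearI[OF f]]
  module_hom.zero[OF module_hom_linearI[OF f]]
  module_hom.scale[OF module_hom_linearI[OF f]]

end

lemma linear_diff:
  assumes "Vector_Spaces.linear s1 s2 f" "Vector_Spaces.linear s1 s2 g"
  shows "Vector_Spaces.linear s1 s2 (\<lambda>x. f x - g x)"
proof -
  interpret vector_space s2
    using assms by (simp add: Vector_Spaces.linear_iff)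
  show ?thesis
    using assms by (simp add: Vector_Spaces.linear_iff algebra_simps)
qed

section \<open>Cochains of low degree\<close>

text \<open>Passes from the list encoding of cochains to functions of finitely many vectors, where
  the calculations take place.\<close>

lemma all_length_iff:
  "(\<forall>xs. length xs = 1 \<longrightarrow> P xs) \<longleftrightarrow> (\<forall>x. P [x])"
  "(\<forall>xs. length xs = 2 \<longrightarrow> P xs) \<longleftrightarrow> (\<forall>x y. P [x, y])"
  "(\<forall>xs. length xs = 3 \<longrightarrow> P xs) \<longleftrightarrow> (\<forall>x y z. P [x, y, z])"
  "(\<forall>xs. length xs = 4 \<longrightarrow> P xs) \<longleftrightarrow> (\<forall>x y z w. P [x, y, z, w])"
  by (auto simp: eval_nat_numeral length_Suc_conv)

lemma all_less_iff:
  "(\<forall>k<1. P k) \<longleftrightarrow> P (0::nat)"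
  "(\<forall>k<2. P k) \<longleftrightarrow> P (0::nat) \<and> P 1"
  "(\<forall>k<3. P k) \<longleftrightarrow> P (0::nat) \<and> P 1 \<and> P 2"
  by (auto simp: eval_nat_numeral less_Suc_eq)

lemma cochains_iff:
  "f \<in> cochains sg sV n \<longleftrightarrow>
     (\<forall>xs. length xs \<noteq> n \<longrightarrow> f xs = 0) \<and>
     (\<forall>xs. length xs = n \<longrightarrow> (\<forall>k<n. Vector_Spaces.linear sg sV (\<lambda>x. f (xs[k := x])))) \<and>
     (\<forall>xs. length xs = n \<longrightarrow> \<not> distinct xs \<longrightarrow> f xs = 0)"
  unfolding cochains_def by blast

lemma cochains_1_iff:
  "f \<in> cochains sg sV 1 \<longleftrightarrow>
    (\<forall>xs. length xs \<noteq> 1 \<longrightarrow> f xs = 0) \<and> Vector_Spaces.linear sg sV (\<lambda>x. f [x])"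
  unfolding cochains_iff all_length_iff all_less_iff by simp

lemma cochains_2_iff:
  "f \<in> cochains sg sV 2 \<longleftrightarrow>
    (\<forall>xs. length xs \<noteq> 2 \<longrightarrow> f xs = 0) \<and>
    (\<forall>y. Vector_Spaces.linear sg sV (\<lambda>x. f [x, y])) \<and>
    (\<forall>x. Vector_Spaces.linear sg sV (\<lambda>y. f [x, y])) \<and>
    (\<forall>x. f [x, x] = 0)"
  unfolding cochains_iff all_length_iff all_less_iff by auto

lemma cochains_3_iff:
  "f \<in> cochains sg sV 3 \<longleftrightarrow>
    (\<forall>xs. length xs \<noteq> 3 \<longrightarrow> f xs = 0) \<and>
    (\<forall>y z. Vector_Spaces.linear sg sV (\<lambda>x. f [x, y, z])) \<and>
    (\<forall>x z. Vector_Spaces.linear sg sV (\<lambda>y. f [x, y, z])) \<and>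
    (\<forall>x y. Vector_Spaces.linear sg sV (\<lambda>z. f [x, y, z])) \<and>
    (\<forall>x y. f [x, x, y] = 0 \<and> f [x, y, x] = 0 \<and> f [y, x, x] = 0)"
  unfolding cochains_iff all_length_iff all_less_iff by (simp add: numeral_2_eq_2, blast)

text \<open>Polarization: expand \<open>f [x + y, x + y] = 0\<close>.\<close>

lemma cochains_2_skew:
  assumes "f \<in> cochains sg sV 2"
  shows "f [x, y] = - f [y, x]"
proof -
  have f: "Vector_Spaces.linear sg sV (\<lambda>x. f [x, y])" "Vector_Spaces.linear sg sV (\<lambda>y. f [x, y])"
    and alt: "f [x, x] = 0" for x y
    using assms by (simp_all add: cochains_2_iff)
  have "f [y, x] + f [x, y] = 0"
    using alt[of "x + y"]
    by (simp add: linear_simps[OF f(1)] linear_simps[OF f(2)] alt[of x] alt[of y])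
  then show ?thesis
    by (simp add: minus_unique)
qed

lemma cochains_comp:
  assumes "Vector_Spaces.linear sV sW h" "f \<in> cochains sg sV n"
  shows "h \<circ> f \<in> cochains sg sW n"
  using assms(2) unfolding cochains_iff
  by (auto simp: linear_simps[OF assms(1)] intro!: linear_comp[OF _ assms(1)])

lemma cochains_comp_cancel:
  assumes h: "Vector_Spaces.linear sV sW h" "inj h" and f: "h \<circ> f \<in> cochains sg sW n"
  shows "f \<in> cochains sg sV n"
proof -
  have "h v = 0 \<longleftrightarrow> v = 0" for v
    using h by (metis inj_def linear_simps(4))
  then show ?thesis
    using f unfolding cochains_iff by (auto intro!: linear_cancel_inj[OF h])
qed

lemma cochains_diff:
  assumes "f \<in> cochains sg sV n" "g \<in> cochains sg sV n"
  shows "(\<lambda>xs. f xs - g xs) \<in> cochains sg sV n"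
  using assms unfolding cochains_iff by (simp add: linear_diff)

section \<open>The Chevalley--Eilenberg coboundary\<close>

lemma ce_d_length: "length xs \<noteq> Suc n \<Longrightarrow> ce_d brg sV act n f xs = 0"
  by (simp add: ce_d_def)

text \<open>On lists of any other length the coboundary is \<open>0\<close> by convention, so only
  the indicated lists need a calculation.\<close>

lemma ce_d_eq_zeroI:
  "(\<And>x y z. ce_d brg sV act 2 f [x, y, z] = 0) \<Longrightarrow> ce_d brg sV act 2 f = (\<lambda>_. 0)"
  "(\<And>x y z w. ce_d brg sV act 3 f [x, y, z, w] = 0) \<Longrightarrow> ce_d brg sV act 3 f = (\<lambda>_. 0)"
proof -
  have "ce_d brg sV act n f = (\<lambda>_. 0)" if "\<forall>xs. length xs = Suc n \<longrightarrow> ce_d brg sV act n f xs = 0" for n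
    using that ce_d_length[of _ n brg sV act f] by (intro ext) blast
  note this[of 2, unfolded Suc_numeral semiring_norm all_length_iff]
    this[of 3, unfolded Suc_numeral semiring_norm all_length_iff]
  then show "(\<And>x y z. ce_d brg sV act 2 f [x, y, z] = 0) \<Longrightarrow> ce_d brg sV act 2 f = (\<lambda>_. 0)"
    "(\<And>x y z w. ce_d brg sV act 3 f [x, y, z, w] = 0) \<Longrightarrow> ce_d brg sV act 3 f = (\<lambda>_. 0)"
    by blast+
qed

lemma ce_d_3:
  assumes "vector_space sV"
  shows "ce_d brg sV act 3 f [x, y, z, w] =
    act x (f [y, z, w]) - act y (f [x, z, w]) + act z (f [x, y, w]) - act w (f [x, y, z])
    - f [brg x y, z, w] + f [brg x z, y, w] - f [brg x w, y, z]
    - f [brg y z, x, w] + f [brg y w, x, z] - f [brg z w, x, y]"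
proof -
  interpret vector_space sV by fact
  show ?thesis
    by (simp add: ce_d_def omit_def eval_nat_numeral lessThan_Suc atMost_Suc algebra_simps)
qed

section \<open>Skew symmetry and the Jacobi identity\<close>

context lie_algebra
begin

lemmas bracket_simps =
  linear_simps[OF bracket_linear_left] linear_simps[OF bracket_linear_right] bracket_self

lemma bracket_skew: "bracket x y = - bracket y x"
proof -
  have "bracket y x + bracket x y = 0"
    using bracket_self[of "x + y"]
    by (simp add: linear_simps[OF bracket_linear_left] linear_simps[OF bracket_linear_right]
      bracket_self[of x] bracket_self[of y])
  then show ?thesis
    by (simp add: minus_unique)
qed

text \<open>The coboundary formula produces brackets nested on the left. Both sides have that shape,
  so as a rewrite rule this is applied only to chosen arguments.\<close>

lemma jacobi_left: "bracket (bracket x y) z = bracket (bracket x z) y - bracket (bracket y z) x"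
proof -
  have "bracket z (bracket x y) = - bracket x (bracket y z) - bracket y (bracket z x)"
    using minus_unique[OF jacobi[of x y z]] by simp
  then show ?thesis
    using bracket_skew[of "bracket x y" z] bracket_skew[of "bracket x z" y]
      bracket_skew[of "bracket y z" x] bracket_skew[of x z]
    by (simp add: bracket_simps)
qed

end

section \<open>Coboundaries of low degree and d d = 0\<close>

context lie_module
begin

lemmas act_simps = linear_simps[OF act_linear_left] linear_simps[OF act_linear_right]

lemmas ce_d_1' = ce_d_1[OF V.vector_space_axioms]
lemmas ce_d_2' = ce_d_2[OF V.vector_space_axioms]
lemmas ce_d_3' = ce_d_3[OF V.vector_space_axioms]

lemma ce_d_diff:
  "ce_d brg sV act n (\<lambda>xs. f xs - g xs) = (\<lambda>xs. ce_d brg sV act n f xs - ce_d brg sV act n g xs)"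
  by (rule ext)
    (simp add: ce_d_def act_simps V.scale_right_diff_distrib sum_subtractf)

lemma ce_d_cochains_1:
  assumes "f \<in> cochains sg sV 1"
  shows "ce_d brg sV act 1 f \<in> cochains sg sV 2"
proof -
  have f: "Vector_Spaces.linear sg sV (\<lambda>x. f [x])"
    using assms unfolding cochains_1_iff by blast
  show ?thesis
    unfolding cochains_2_iff Vector_Spaces.linear_iff ce_d_1'
    by (auto simp: ce_d_length linear_simps[OF f] act_simps L.bracket_simps
      L.vector_space_axioms V.vector_space_axioms algebra_simps)
qed

lemma ce_d_cochains_2:
  assumes "f \<in> cochains sg sV 2"
  shows "ce_d brg sV act 2 f \<in> cochains sg sV 3"
proof -
  have f: "Vector_Spaces.linear sg sV (\<lambda>x. f [x, y])" "Vector_Spaces.linear sg sV (\<lambda>y. f [x, y])"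
    and alt: "f [x, x] = 0" for x y
    using assms by (simp_all add: cochains_2_iff)
  note simps = linear_simps[OF f(1)] linear_simps[OF f(2)] alt act_simps L.bracket_simps
  have skew: "f [brg y x, z] = - f [brg x y, z]" for x y z
    by (subst L.bracket_skew) (simp add: simps)
  have "ce_d brg sV act 2 f [x, x, y] = 0 \<and> ce_d brg sV act 2 f [x, y, x] = 0 \<and>
      ce_d brg sV act 2 f [y, x, x] = 0" for x y
    \<comment> \<open>Only the pattern \<open>[x, y, x]\<close> needs skew symmetry, once of
      \<open>f\<close> and once of the bracket. When equal entries are adjacent, the terms cancel as
      they stand.\<close>
    using cochains_2_skew[OF assms, of y x] skew[of y x x]
    unfolding ce_d_2' by (simp add: simps)
  then show ?thesis
    unfolding cochains_3_iff Vector_Spaces.linear_iff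
    by (simp add: ce_d_length ce_d_2' simps L.vector_space_axioms V.vector_space_axioms algebra_simps)
qed

lemma ce_d_ce_d_1:
  assumes "f \<in> cochains sg sV 1"
  shows "ce_d brg sV act 2 (ce_d brg sV act 1 f) = (\<lambda>_. 0)"
proof -
  have f: "Vector_Spaces.linear sg sV (\<lambda>x. f [x])"
    using assms unfolding cochains_1_iff by blast
  have "ce_d brg sV act 2 (ce_d brg sV act 1 f) [x, y, z] = 0" for x y z
    unfolding ce_d_1' ce_d_2' L.jacobi_left[of x y z]
    by (simp add: linear_simps[OF f] act_simps act_bracket algebra_simps)
  then show ?thesis by (rule ce_d_eq_zeroI)
qed

lemma ce_d_ce_d_2:
  assumes "f \<in> cochains sg sV 2"
  shows "ce_d brg sV act 3 (ce_d brg sV act 2 f) = (\<lambda>_. 0)"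
proof -
  have f: "Vector_Spaces.linear sg sV (\<lambda>x. f [x, y])" "Vector_Spaces.linear sg sV (\<lambda>y. f [x, y])" for x y
    using assms by (simp_all add: cochains_2_iff)
  note skew = cochains_2_skew[OF assms]
  have "ce_d brg sV act 3 (ce_d brg sV act 2 f) [x, y, z, w] = 0" for x y z w
    \<comment> \<open>Each triple of the four arguments contributes one Jacobi identity. Each
      splitting into two pairs contributes one use of \<open>skew\<close>, which puts the values of
      \<open>f\<close> on two brackets in a common order. The action terms cancel by
      \<open>act_bracket\<close>.\<close>
    unfolding ce_d_3' ce_d_2' L.jacobi_left[of x y z] L.jacobi_left[of x y w]
      L.jacobi_left[of x z w] L.jacobi_left[of y z w]
      skew[of "brg z w" "brg x y"] skew[of "brg y w" "brg x z"] skew[of "brg y z" "brg x w"]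
    by (simp add: linear_simps[OF f(1)] linear_simps[OF f(2)] act_simps act_bracket algebra_simps)
  then show ?thesis by (rule ce_d_eq_zeroI)
qed

end

lemma (in lie_module_hom) ce_d_comp:
  "ce_d brg sW actW n (f \<circ> b) = f \<circ> ce_d brg sV actV n b"
proof
  fix xs
  interpret f: Vector_Spaces.linear sV sW f by (rule linear)
  show "ce_d brg sW actW n (f \<circ> b) xs = (f \<circ> ce_d brg sV actV n b) xs"
    by (simp only: ce_d_def if_distrib[of f] comp_apply f.add f.sum f.scale f.zero equivariant)
qed


lemma coboundaries_Suc: "coboundaries sg brg sV act (Suc n) = ce_d brg sV act n ` cochains sg sV n"
  by (simp add: coboundaries_def)

lemma cohomologous_iff:
  "(f, g) \<in> cohomologous sg brg sV act (Suc n) \<longleftrightarrow>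
     f \<in> cocycles sg brg sV act (Suc n) \<and> g \<in> cocycles sg brg sV act (Suc n) \<and>
     (\<exists>c \<in> cochains sg sV n. \<forall>xs. f xs - g xs = ce_d brg sV act n c xs)"
  by (auto simp: cohomologous_def coboundaries_Suc image_iff fun_eq_iff)

section \<open>The connecting homomorphism\<close>

context short_exact_modules
begin

lemma inj_i: "inj i" and range_i: "range i = {v. p v = 0}" and surj_p: "surj p"
  using exact by (simp_all add: short_exact_def)

lemma p_i: "p (i v) = 0"
  using range_i by blast

lemma factor_through_i:
  assumes "\<And>x. p (h x) = 0"
  obtains g where "i \<circ> g = h"
proof -
  have "\<forall>x. \<exists>v. i v = h x"
    using assms range_i by (metis (mono_tags) imageE mem_Collect_eq)
  then show thesis
    using that by (metis comp_apply ext)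
qed

text \<open>With \<open>cochain_lift\<close> this supplies the exactness of the cochain sequence on
  which the diagram chase rests.\<close>

lemma cochain_kernel:
  assumes "b \<in> cochains sg s2 n" "\<And>xs. p (b xs) = 0"
  obtains c where "c \<in> cochains sg s1 n" "i \<circ> c = b"
  using assms factor_through_i cochains_comp_cancel[OF incl.linear inj_i] by metis

text \<open>Over a field \<open>p\<close> has a linear section. It need not be equivariant, so the
  lift of a cocycle need not be closed; this failure is what the connecting homomorphism
  measures.\<close>

lemma cochain_lift:
  assumes "c \<in> cochains sg s3 n"
  obtains b where "b \<in> cochains sg s2 n" "p \<circ> b = c"
proof -
  obtain s where "Vector_Spaces.linear s3 s2 s" and s: "\<And>v. p (s v) = v"
    using linear_section[OF proj.linear surj_p] by blast
  then have "s \<circ> c \<in> cochains sg s2 n" "p \<circ> (s \<circ> c) = c"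
    using assms by (auto simp: cochains_comp)
  then show thesis by (rule that)
qed

text \<open>Naturality gives i(dg) = d(db) = 0, and \<open>i\<close> is injective.\<close>

lemma pullback_cocycle:
  assumes b: "b \<in> cochains sg s2 2" and g: "i \<circ> g = ce_d brg s2 act2 2 b"
  shows "g \<in> cocycles sg brg s1 act1 3"
proof -
  have "g \<in> cochains sg s1 3"
    using cochains_comp_cancel[OF incl.linear inj_i] incl.cod.ce_d_cochains_2[OF b] g by metis
  moreover have "i \<circ> ce_d brg s1 act1 3 g = (\<lambda>_. 0)"
    using incl.ce_d_comp[of 3 g] incl.cod.ce_d_ce_d_2[OF b] g by simp
  then have "i (ce_d brg s1 act1 3 g xs) = i 0" for xs
    by (simp add: fun_eq_iff linear_simps[OF incl.linear])
  then have "ce_d brg s1 act1 3 g = (\<lambda>_. 0)"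
    using inj_i by (simp add: inj_eq fun_eq_iff)
  ultimately show ?thesis
    by (simp add: cocycles_def)
qed

lemma image_cocycle:
  assumes b: "b \<in> cochains sg s2 2" and g: "i \<circ> g = ce_d brg s2 act2 2 b"
  shows "p \<circ> b \<in> cocycles sg brg s3 act3 2"
proof -
  have "ce_d brg s3 act3 2 (p \<circ> b) = (\<lambda>_. 0)"
    unfolding proj.ce_d_comp g[symmetric] by (simp add: fun_eq_iff p_i)
  then show ?thesis
    using cochains_comp[OF proj.linear b] by (simp add: cocycles_def)
qed

text \<open>The diagram chase showing that one lift determines the whole set of outcomes: other
  choices of representative and lift change \<open>g\<close> exactly by coboundaries.\<close>

lemma connecting_hom_eq:
  assumes b: "b \<in> cochains sg s2 2" and g: "i \<circ> g = ce_d brg s2 act2 2 b"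
    and a: "(a, p \<circ> b) \<in> cohomologous sg brg s3 act3 2"
  shows "connecting_hom sg brg s1 act1 s2 act2 i p 2 (cohomology_class sg brg s3 act3 2 a) =
    cohomology_class sg brg s1 act1 3 g"
proof (intro equalityI subsetI)
  note coh2 = cohomologous_iff[where n = 1, unfolded Suc_1]
    and coh3 = cohomologous_iff[where n = 2, unfolded Suc_numeral semiring_norm]
  obtain e where e: "e \<in> cochains sg s3 1" and ea: "\<And>xs. a xs - p (b xs) = ce_d brg s3 act3 1 e xs"
    using a by (auto simp: coh2)
  fix h
  {
    assume "h \<in> connecting_hom sg brg s1 act1 s2 act2 i p 2 (cohomology_class sg brg s3 act3 2 a)"
    then obtain b' where h: "h \<in> cocycles sg brg s1 act1 3"
      and b': "b' \<in> cochains sg s2 2" "i \<circ> h = ce_d brg s2 act2 2 b'"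
      and "(a, p \<circ> b') \<in> cohomologous sg brg s3 act3 2"
      by (auto simp: connecting_hom_def cohomology_class_def)
    then obtain e' where "e' \<in> cochains sg s3 1" and e': "\<And>xs. a xs - p (b' xs) = ce_d brg s3 act3 1 e' xs"
      by (auto simp: coh2)
    then have "(\<lambda>xs. e' xs - e xs) \<in> cochains sg s3 1"
      using e by (simp add: cochains_diff)
    then obtain t where t: "t \<in> cochains sg s2 1" "p \<circ> t = (\<lambda>xs. e' xs - e xs)"
      by (rule cochain_lift)
    \<comment> \<open>The images of \<open>b\<close> and \<open>b'\<close> under \<open>p\<close>
      differ by the coboundary of \<open>e' - e\<close>. Subtracting the coboundary of its lift
      \<open>t\<close> brings the difference into the kernel of \<open>p\<close> without changing
      its coboundary.\<close>
    define r where "r = (\<lambda>xs. (b xs - b' xs) - ce_d brg s2 act2 1 t xs)"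
    have r: "r \<in> cochains sg s2 2"
      unfolding r_def by (intro cochains_diff b b' incl.cod.ce_d_cochains_1 t)
    have "p (ce_d brg s2 act2 1 t xs) = ce_d brg s3 act3 1 e' xs - ce_d brg s3 act3 1 e xs" for xs
      using proj.ce_d_comp[of 1 t] unfolding t proj.cod.ce_d_diff by (metis comp_apply)
    then have "p (r xs) = 0" for xs
      unfolding r_def linear_simps[OF proj.linear]
      by (simp only: ea[symmetric] e'[symmetric]) simp
    then obtain c where c: "c \<in> cochains sg s1 2" "i \<circ> c = r"
      using cochain_kernel[OF r] by blast
    have "i (g xs - h xs) = i (ce_d brg s1 act1 2 c xs)" for xs
    proof -
      have "i (ce_d brg s1 act1 2 c xs) = ce_d brg s2 act2 2 r xs"
        using incl.ce_d_comp[of 2 c] c by (metis comp_apply)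
      also have "\<dots> = i (g xs) - i (h xs)"
        unfolding r_def incl.cod.ce_d_diff incl.cod.ce_d_ce_d_1[OF t(1)]
        using g b'(2) by (metis comp_apply diff_zero)
      finally show ?thesis
        by (simp add: linear_simps[OF incl.linear])
    qed
    then have "g xs - h xs = ce_d brg s1 act1 2 c xs" for xs
      using inj_i by (simp add: inj_eq)
    then show "h \<in> cohomology_class sg brg s1 act1 3 g"
      using h c pullback_cocycle[OF b g] by (auto simp: cohomology_class_def coh3)
  next
    assume "h \<in> cohomology_class sg brg s1 act1 3 g"
    then obtain c where h: "h \<in> cocycles sg brg s1 act1 3" and c: "c \<in> cochains sg s1 2"
      and d: "\<And>xs. g xs - h xs = ce_d brg s1 act1 2 c xs"
      by (auto simp: cohomology_class_def coh3)
    \<comment> \<open>Changing \<open>g\<close> by the coboundary of \<open>c\<close> amounts to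
      changing the lift by \<open>i \<circ> c\<close>, which \<open>p\<close> does not see.\<close>
    define b' where "b' = (\<lambda>xs. b xs - (i \<circ> c) xs)"
    have b': "b' \<in> cochains sg s2 2"
      unfolding b'_def by (intro cochains_diff b cochains_comp[OF incl.linear] c)
    have "p \<circ> b' = p \<circ> b"
      by (simp add: b'_def fun_eq_iff linear_simps[OF proj.linear] p_i)
    then have "p \<circ> b' \<in> cohomology_class sg brg s3 act3 2 a"
      using a by (simp add: cohomology_class_def)
    moreover have "i \<circ> h = ce_d brg s2 act2 2 b'"
      unfolding b'_def incl.cod.ce_d_diff incl.ce_d_comp g[symmetric]
      by (simp add: fun_eq_iff d[symmetric] linear_simps[OF incl.linear])
    ultimately show "h \<in> connecting_hom sg brg s1 act1 s2 act2 i p 2 (cohomology_class sg brg s3 act3 2 a)"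
      using h b' by (auto simp: connecting_hom_def)
  }
qed

end

section \<open>Abelian extensions\<close>

text \<open>The Lie algebra axioms are identities, so they can be checked after an injection. In
  this way the twisted bracket obtains its Jacobi identity from the extension.\<close>

lemma lie_hom_pullback:
  assumes alg: "lie_algebra s2 br2" and f: "Vector_Spaces.linear s1 s2 f" "inj f"
    and hom: "\<And>x y. f (br1 x y) = br2 (f x) (f y)"
  shows "lie_hom s1 br1 s2 br2 f"
proof -
  interpret cod: lie_algebra s2 br2 by fact
  interpret dom: vector_space s1
    using f by (simp add: Vector_Spaces.linear_iff)
  note eq_iff = inj_eq[OF f(2), symmetric]
  have "lie_algebra s1 br1"
  proof (intro lie_algebra.intro lie_algebra_axioms.intro dom.vector_space_axioms)
    show "Vector_Spaces.linear s1 s1 (\<lambda>x. br1 x y)" for y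
      unfolding Vector_Spaces.linear_iff
      by (simp add: eq_iff hom linear_simps[OF f(1)] cod.bracket_simps dom.vector_space_axioms)
    show "Vector_Spaces.linear s1 s1 (br1 x)" for x
      unfolding Vector_Spaces.linear_iff
      by (simp add: eq_iff hom linear_simps[OF f(1)] cod.bracket_simps dom.vector_space_axioms)
    show "br1 x x = 0" for x
      by (simp add: eq_iff hom linear_simps[OF f(1)] cod.bracket_simps)
    show "br1 x (br1 y z) + br1 y (br1 z x) + br1 z (br1 x y) = 0" for x y z
      by (simp add: eq_iff hom linear_simps[OF f(1)] cod.jacobi)
  qed
  then show ?thesis
    using alg f(1) hom by (simp add: lie_hom_def lie_hom_axioms_def)
qed

section \<open>Linear sections of an abelian extension and their cocycles\<close>

context abelian_extension
begin

lemmas j_simps = linear_simps[OF incl.linear]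
lemmas q_simps = linear_simps[OF proj.linear]

lemma inj_j: "inj j" and range_j: "range j = {e. q e = 0}" and surj_q: "surj q"
  using exact by (simp_all add: short_exact_def)

lemma q_j: "q (j v) = 0"
  using range_j by blast

lemma bracket_j_left: "bre (j v) e = - j (act (q e) v)"
  using incl.cod.bracket_skew[of "j v" e] by (simp add: induced_action)

lemma bracket_j_j: "bre (j v) (j w) = 0"
  by (simp add: induced_action q_j module.act_simps j_simps)

text \<open>The defect of \<open>\<sigma>\<close> from being a homomorphism is killed by
  \<open>q\<close>, so exactness places it in the range of \<open>j\<close>; injectivity of
  \<open>j\<close> carries over bilinearity and alternation.\<close>

lemma section_cochain:
  assumes \<sigma>: "Vector_Spaces.linear sg se \<sigma>" "\<And>x. q (\<sigma> x) = x"
  obtains \<alpha> where "\<alpha> \<in> cochains sg sV 2"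
    "\<And>x y. j (\<alpha> [x, y]) = bre (\<sigma> x) (\<sigma> y) - \<sigma> (brg x y)"
proof -
  define D where "D x y = bre (\<sigma> x) (\<sigma> y) - \<sigma> (brg x y)" for x y
  have "q (D x y) = 0" for x y
    by (simp add: D_def q_simps proj.hom \<sigma>)
  then have "\<forall>x y. \<exists>v. j v = D x y"
    using range_j by (metis (mono_tags) imageE mem_Collect_eq)
  then obtain a where a: "\<And>x y. j (a x y) = D x y" by metis
  define \<alpha> where "\<alpha> xs = (if length xs = 2 then a (xs ! 0) (xs ! 1) else 0)" for xs
  have j\<alpha>: "j (\<alpha> [x, y]) = D x y" for x y
    by (simp add: \<alpha>_def a)
  note simps = linear_simps[OF \<sigma>(1)] incl.cod.bracket_simps module.L.bracket_simps D_def
  have "Vector_Spaces.linear sg se (\<lambda>x. D x y)" "Vector_Spaces.linear sg se (\<lambda>x. D y x)" for y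
    unfolding Vector_Spaces.linear_iff
    by (simp_all add: simps incl.cod.vector_space_axioms module.L.vector_space_axioms algebra_simps)
  then have lin: "Vector_Spaces.linear sg sV (\<lambda>x. \<alpha> [x, y])"
    "Vector_Spaces.linear sg sV (\<lambda>x. \<alpha> [y, x])" for y
    unfolding j\<alpha>[symmetric] by (auto intro: linear_cancel_inj[OF incl.linear inj_j])
  have "\<alpha> [x, x] = 0" for x
    by (simp add: inj_eq[OF inj_j, symmetric] j\<alpha> j_simps simps)
  then have "\<alpha> \<in> cochains sg sV 2"
    unfolding cochains_2_iff using lin by (simp add: \<alpha>_def)
  with j\<alpha> that show thesis by (simp add: D_def)
qed

lemma section_cocycle:
  assumes \<sigma>: "Vector_Spaces.linear sg se \<sigma>" "\<And>x. q (\<sigma> x) = x"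
    and \<alpha>: "\<alpha> \<in> cochains sg sV 2" "\<And>x y. j (\<alpha> [x, y]) = bre (\<sigma> x) (\<sigma> y) - \<sigma> (brg x y)"
  shows "\<alpha> \<in> cocycles sg brg sV act 2"
proof -
  have act: "j (act x v) = bre (\<sigma> x) (j v)" for x v
    by (simp add: induced_action \<sigma>)
  have "j (ce_d brg sV act 2 \<alpha> [x, y, z]) = j 0" for x y z
  proof -
    \<comment> \<open>The last summand cancels an action term of the coboundary. What remains are
      double brackets, which vanish by the Jacobi identities of both algebras.\<close>
    have br: "bre (\<sigma> (brg x y)) (\<sigma> z) = bre (bre (\<sigma> x) (\<sigma> y)) (\<sigma> z) + bre (\<sigma> z) (j (\<alpha> [x, y]))" for x y z
    proof -
      have "\<sigma> (brg x y) = bre (\<sigma> x) (\<sigma> y) - j (\<alpha> [x, y])"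
        by (simp add: \<alpha>)
      then show ?thesis
        using incl.cod.bracket_skew[of "j (\<alpha> [x, y])" "\<sigma> z"]
        by (simp add: incl.cod.bracket_simps)
    qed
    show ?thesis
      unfolding module.ce_d_2' j_simps act
      \<comment> \<open>The pattern \<open>brg _ _\<close> leaves the values of
        \<open>\<alpha>\<close> inside the action terms folded, as the cancellation against
        \<open>br\<close> requires.\<close>
      unfolding \<alpha>(2)[of "brg _ _"] br module.L.jacobi_left[of x y z]
        incl.cod.jacobi_left[of "\<sigma> x" "\<sigma> y" "\<sigma> z"]
      by (simp add: linear_simps[OF \<sigma>(1)])
  qed
  then have "ce_d brg sV act 2 \<alpha> = (\<lambda>_. 0)"
    using inj_j by (intro ce_d_eq_zeroI) (simp add: inj_eq)
  with \<alpha>(1) show ?thesis by (simp add: cocycles_def)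
qed

text \<open>The section splits the extension linearly into the ranges of \<open>j\<close> and
  \<open>\<sigma>\<close>; in these coordinates its bracket is the twisted one.\<close>

lemma section_defining_cocycle:
  assumes \<sigma>: "Vector_Spaces.linear sg se \<sigma>" "\<And>x. q (\<sigma> x) = x"
    and \<alpha>: "\<alpha> \<in> cochains sg sV 2" "\<And>x y. j (\<alpha> [x, y]) = bre (\<sigma> x) (\<sigma> y) - \<sigma> (brg x y)"
  shows "defining_cocycle sg brg sV act se bre j q \<alpha>"
proof -
  interpret prod: vector_space_prod sV sg
    by unfold_locales
  define \<phi> where "\<phi> = (\<lambda>(v, x). j v + \<sigma> x)"
  have \<phi>: "\<phi> (v, x) = j v + \<sigma> x" for v x
    by (simp add: \<phi>_def)
  have q\<phi>: "q (\<phi> (v, x)) = x" for v x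
    by (simp add: \<phi> q_simps q_j \<sigma>)
  have "inj \<phi>"
  proof (rule injI, clarify)
    fix v x w y assume eq: "\<phi> (v, x) = \<phi> (w, y)"
    then have "x = y" using q\<phi> by metis
    with eq show "v = w \<and> x = y" using inj_j by (simp add: \<phi> inj_eq)
  qed
  moreover have "surj \<phi>"
  proof -
    have "\<exists>z. e = \<phi> z" for e
    proof -
      have "q (e - \<sigma> (q e)) = 0" by (simp add: q_simps \<sigma>)
      then obtain v where "e - \<sigma> (q e) = j v" using range_j by blast
      then have "e = \<phi> (v, q e)" by (simp add: \<phi> algebra_simps)
      then show ?thesis by blast
    qed
    then show ?thesis by (simp add: surj_def)
  qed
  moreover have "Vector_Spaces.linear (module_prod.scale sV sg) se \<phi>"
    unfolding Vector_Spaces.linear_iff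
    by (auto simp: \<phi> prod.scale_prod j_simps linear_simps[OF \<sigma>(1)] algebra_simps
      prod.p.vector_space_axioms incl.cod.vector_space_axioms)
  moreover have "\<phi> (twisted_bracket brg act \<alpha> a b) = bre (\<phi> a) (\<phi> b)" for a b
    by (cases a; cases b)
      (simp add: twisted_bracket_def \<phi> j_simps \<alpha> \<sigma> incl.cod.bracket_simps bracket_j_j
        bracket_j_left induced_action q_simps q_j algebra_simps)
  ultimately have "lie_hom (module_prod.scale sV sg) (twisted_bracket brg act \<alpha>) se bre \<phi>" "bij \<phi>"
    by (auto intro: lie_hom_pullback incl.cod.lie_algebra_axioms simp: bij_def)
  moreover have "\<phi> (v, 0) = j v" for v
    by (simp add: \<phi> linear_simps[OF \<sigma>(1)])
  ultimately show ?thesis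
    unfolding defining_cocycle_def using q\<phi> section_cocycle[OF assms] by blast
qed

text \<open>Conversely, an equivalence restricts to a section on the second summand, where the
  action terms of the twisted bracket vanish.\<close>

lemma defining_cocycle_section:
  assumes "defining_cocycle sg brg sV act se bre j q \<alpha>"
  obtains \<sigma> where "Vector_Spaces.linear sg se \<sigma>" "\<And>x. q (\<sigma> x) = x"
    "\<And>x y. j (\<alpha> [x, y]) = bre (\<sigma> x) (\<sigma> y) - \<sigma> (brg x y)"
proof -
  obtain \<phi> where "lie_hom (module_prod.scale sV sg) (twisted_bracket brg act \<alpha>) se bre \<phi>"
    and j: "\<And>v. \<phi> (v, 0) = j v" and q: "\<And>v x. q (\<phi> (v, x)) = x"
    using assms by (auto simp: defining_cocycle_def)
  then interpret \<phi>: lie_hom "module_prod.scale sV sg" "twisted_bracket brg act \<alpha>" se bre \<phi>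
    by blast
  interpret prod: vector_space_prod sV sg
    by unfold_locales
  show thesis
  proof
    show "Vector_Spaces.linear sg se (\<lambda>x. \<phi> (0, x))"
      unfolding Vector_Spaces.linear_iff
      by (simp add: linear_simps[OF \<phi>.linear, symmetric] prod.scale_prod
        incl.cod.vector_space_axioms module.L.vector_space_axioms)
    show "q (\<phi> (0, x)) = x" for x by (rule q)
    show "j (\<alpha> [x, y]) = bre (\<phi> (0, x)) (\<phi> (0, y)) - \<phi> (0, brg x y)" for x y
      by (simp add: \<phi>.hom[symmetric] twisted_bracket_def module.act_simps j[symmetric]
        linear_simps[OF \<phi>.linear, symmetric])
  qed
qed

lemma section_difference:
  assumes "Vector_Spaces.linear sg se \<rho>" "\<And>x. q (\<rho> x) = x"
    and "Vector_Spaces.linear sg se \<sigma>" "\<And>x. q (\<sigma> x) = x"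
  obtains \<eta> where "Vector_Spaces.linear sg sV \<eta>" "\<And>x. \<rho> x = \<sigma> x + j (\<eta> x)"
proof -
  have "\<forall>x. \<exists>v. j v = \<rho> x - \<sigma> x"
    using assms(2,4) range_j by (metis (mono_tags) diff_self imageE mem_Collect_eq q_simps(2))
  then obtain \<eta> where \<eta>: "\<And>x. j (\<eta> x) = \<rho> x - \<sigma> x" by metis
  then have "Vector_Spaces.linear sg sV \<eta>"
    using linear_diff[OF assms(1,3)] by (auto intro: linear_cancel_inj[OF incl.linear inj_j])
  with \<eta> that show thesis by simp
qed

text \<open>Two sections differ by \<open>j \<circ> \<eta>\<close>. Expanding the brackets gives the
  coboundary of \<open>\<eta>\<close>, since the quadratic term
  \<open>bre (j (\<eta> x)) (j (\<eta> y))\<close> vanishes.\<close>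

lemma section_cochains_cohomologous:
  assumes \<rho>: "Vector_Spaces.linear sg se \<rho>" "\<And>x. q (\<rho> x) = x"
    and \<sigma>: "Vector_Spaces.linear sg se \<sigma>" "\<And>x. q (\<sigma> x) = x"
    and a: "a \<in> cocycles sg brg sV act 2" "\<And>x y. j (a [x, y]) = bre (\<rho> x) (\<rho> y) - \<rho> (brg x y)"
    and b: "b \<in> cocycles sg brg sV act 2" "\<And>x y. j (b [x, y]) = bre (\<sigma> x) (\<sigma> y) - \<sigma> (brg x y)"
  shows "(a, b) \<in> cohomologous sg brg sV act 2"
proof -
  obtain \<eta> where lin: "Vector_Spaces.linear sg sV \<eta>" and \<eta>: "\<And>x. \<rho> x = \<sigma> x + j (\<eta> x)"
    using section_difference[OF \<rho> \<sigma>] by blast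
  define c where "c xs = (if length xs = 1 then \<eta> (xs ! 0) else 0)" for xs
  have c: "c \<in> cochains sg sV 1"
    unfolding cochains_1_iff using lin by (simp add: c_def)
  have "j (a [x, y] - b [x, y]) = j (ce_d brg sV act 1 c [x, y])" for x y
    unfolding module.ce_d_1' j_simps a b \<eta>
    by (simp add: c_def j_simps incl.cod.bracket_simps bracket_j_j bracket_j_left
      induced_action \<sigma> q_simps q_j algebra_simps)
  then have "a [x, y] - b [x, y] = ce_d brg sV act 1 c [x, y]" for x y
    using inj_j by (simp add: inj_eq)
  then have "\<forall>xs. length xs = 2 \<longrightarrow> a xs - b xs = ce_d brg sV act 1 c xs"
    unfolding all_length_iff by blast
  moreover have "a xs - b xs = ce_d brg sV act 1 c xs" if "length xs \<noteq> 2" for xs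
    using that a b by (simp add: cocycles_def cochains_iff ce_d_length)
  ultimately have "\<forall>xs. a xs - b xs = ce_d brg sV act 1 c xs" by blast
  then show ?thesis
    unfolding cohomologous_iff[where n = 1, unfolded Suc_1] using a b c by blast
qed

end

section \<open>The Yoneda product\<close>

text \<open>The Peiffer identity reads 0 = 0 because q j = 0, and equivariance combines that of
  \<open>p\<close> with the induced action on \<open>j\<close>. Injectivity of \<open>j\<close>
  identifies the kernel with that of \<open>p\<close>; surjectivity of \<open>p\<close> identifies
  the image with the kernel of \<open>q\<close>.\<close>

lemma yoneda_crossed_module:
  assumes A: "short_exact_modules sg brg s1 act1 s2 act2 s3 act3 i p"
    and B: "abelian_extension sg brg s3 act3 se bre j q"
  shows "crossed_module_ker_coker sg brg s1 act1 s2 (\<lambda>_ _. 0) se bre i (j \<circ> p) q (\<lambda>e. act2 (q e))"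
proof -
  interpret A: short_exact_modules sg brg s1 act1 s2 act2 s3 act3 i p by fact
  interpret B: abelian_extension sg brg s3 act3 se bre j q by fact
  note act2_simps = A.incl.cod.act_simps
  interpret zero: lie_algebra s2 "\<lambda>_ _. 0"
    by unfold_locales simp_all
  interpret pull: lie_module se bre s2 "\<lambda>e. act2 (q e)"
  proof (intro lie_module.intro lie_module_axioms.intro B.incl.cod.lie_algebra_axioms
      A.incl.cod.V.vector_space_axioms)
    show "Vector_Spaces.linear se s2 (\<lambda>e. act2 (q e) v)" for v
      using linear_comp[OF B.proj.linear A.incl.cod.act_linear_left] .
    show "Vector_Spaces.linear s2 s2 (act2 (q e))" for e
      by (rule A.incl.cod.act_linear_right)
    show "act2 (q (bre e e')) v = act2 (q e) (act2 (q e') v) - act2 (q e') (act2 (q e) v)" for e e' v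
      by (simp add: B.proj.hom A.incl.cod.act_bracket)
  qed
  have ker: "(j \<circ> p) v = 0 \<longleftrightarrow> p v = 0" for v
    using B.inj_j B.j_simps(4) by (metis comp_apply inj_eq)
  show ?thesis
  proof (intro crossed_module_ker_coker.intro crossed_module_ker_coker_axioms.intro
      crossed_module.intro crossed_module_axioms.intro lie_hom.intro lie_hom_axioms.intro
      zero.lie_algebra_axioms B.incl.cod.lie_algebra_axioms pull.lie_module_axioms
      A.incl.dom.lie_module_axioms A.incl.dom.L.lie_algebra_axioms B.proj.linear B.proj.hom)
    show "Vector_Spaces.linear s2 se (j \<circ> p)"
      by (rule Vector_Spaces.linear_compose[OF A.proj.linear B.incl.linear])
    show "(j \<circ> p) 0 = bre ((j \<circ> p) x) ((j \<circ> p) y)" for x y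
      by (simp add: B.bracket_j_j B.j_simps linear_simps[OF A.proj.linear])
    show "act2 (q n) 0 = 0 + 0" for n
      by (simp add: act2_simps)
    show "(j \<circ> p) (act2 (q n) m) = bre n ((j \<circ> p) m)" for n m
      by (simp add: A.proj.equivariant B.induced_action)
    show "act2 (q ((j \<circ> p) m)) m' = 0" for m m'
      by (simp add: B.q_j act2_simps)
    show "Vector_Spaces.linear s1 s2 i" "inj i"
      by (rule A.incl.linear A.inj_i)+
    show "range i = {m. (j \<circ> p) m = 0}"
      unfolding ker by (rule A.range_i)
    show "{n. q n = 0} = range (j \<circ> p)"
      using B.range_j A.surj_p by (metis image_comp)
    show "surj q" by (rule B.surj_q)
    show "i (act1 (q n) v) = act2 (q n) (i v)" for n v
      by (rule A.incl.equivariant)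
  qed
qed

text \<open>The existence claims keep the final universal claim from being vacuous. Equality of sets
  of cocycles there says both that the connecting homomorphism yields a single class and that it is
  the class of \<open>\<gamma>\<close>.\<close>

theorem theorem3:
  fixes sg :: "'k::field \<Rightarrow> 'g::ab_group_add \<Rightarrow> 'g" and brg :: "'g \<Rightarrow> 'g \<Rightarrow> 'g"
    and s1 :: "'k \<Rightarrow> 'v1::ab_group_add \<Rightarrow> 'v1" and act1 :: "'g \<Rightarrow> 'v1 \<Rightarrow> 'v1"
    and s2 :: "'k \<Rightarrow> 'v2::ab_group_add \<Rightarrow> 'v2" and act2 :: "'g \<Rightarrow> 'v2 \<Rightarrow> 'v2"
    and s3 :: "'k \<Rightarrow> 'v3::ab_group_add \<Rightarrow> 'v3" and act3 :: "'g \<Rightarrow> 'v3 \<Rightarrow> 'v3"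
    and se :: "'k \<Rightarrow> 'e::ab_group_add \<Rightarrow> 'e" and bre :: "'e \<Rightarrow> 'e \<Rightarrow> 'e"
    and i :: "'v1 \<Rightarrow> 'v2" and p :: "'v2 \<Rightarrow> 'v3"
    and j :: "'v3 \<Rightarrow> 'e" and q :: "'e \<Rightarrow> 'g"
  assumes lie_algebra: "lie_algebra sg brg"
    and A: "short_exact_modules sg brg s1 act1 s2 act2 s3 act3 i p"
    and B: "abelian_extension sg brg s3 act3 se bre j q"
  shows
    "crossed_module_ker_coker sg brg s1 act1 s2 (\<lambda>_ _. 0) se bre i (j \<circ> p) q (\<lambda>e. act2 (q e)) \<and>
     (\<exists>\<alpha>. defining_cocycle sg brg s3 act3 se bre j q \<alpha>) \<and>
     (\<exists>\<gamma>. associated_cocycle sg brg s2 se bre i (j \<circ> p) q (\<lambda>e. act2 (q e)) \<gamma>) \<and>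
     (\<forall>\<alpha> \<gamma>. defining_cocycle sg brg s3 act3 se bre j q \<alpha> \<longrightarrow>
        associated_cocycle sg brg s2 se bre i (j \<circ> p) q (\<lambda>e. act2 (q e)) \<gamma> \<longrightarrow>
        \<gamma> \<in> cocycles sg brg s1 act1 3 \<and>
        cohomology_class sg brg s1 act1 3 \<gamma> =
          connecting_hom sg brg s1 act1 s2 act2 i p 2 (cohomology_class sg brg s3 act3 2 \<alpha>))"
proof -
  interpret A: short_exact_modules sg brg s1 act1 s2 act2 s3 act3 i p by fact
  interpret B: abelian_extension sg brg s3 act3 se bre j q by fact
  obtain \<sigma> where \<sigma>: "Vector_Spaces.linear sg se \<sigma>" "\<And>x. q (\<sigma> x) = x"
    using linear_section[OF B.proj.linear B.surj_q] by blast
  obtain \<alpha> where \<alpha>: "\<alpha> \<in> cochains sg s3 2"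
    "\<And>x y. j (\<alpha> [x, y]) = bre (\<sigma> x) (\<sigma> y) - \<sigma> (brg x y)"
    using B.section_cochain[OF \<sigma>] by blast
  have "\<exists>\<gamma>. associated_cocycle sg brg s2 se bre i (j \<circ> p) q (\<lambda>e. act2 (q e)) \<gamma>"
  proof -
    \<comment> \<open>Any lift of the cocycle of \<open>\<sigma>\<close> meets the requirement on
      \<open>\<beta>\<close>, as \<open>j \<circ> p\<close> sends it to the defect of
      \<open>\<sigma>\<close>.\<close>
    obtain \<beta> where \<beta>: "\<beta> \<in> cochains sg s2 2" "p \<circ> \<beta> = \<alpha>"
      using A.cochain_lift[OF \<alpha>(1)] .
    have "p (ce_d brg s2 act2 2 \<beta> xs) = 0" for xs
      using A.proj.ce_d_comp[of 2 \<beta>] B.section_cocycle[OF \<sigma> \<alpha>]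
      by (simp add: \<beta> cocycles_def fun_eq_iff)
    then obtain \<gamma> where "i \<circ> \<gamma> = ce_d brg s2 act2 2 \<beta>"
      using A.factor_through_i by blast
    moreover have "(j \<circ> p) (\<beta> [x, y]) = bre (\<sigma> x) (\<sigma> y) - \<sigma> (brg x y)" for x y
      using \<alpha>(2)[of x y] \<beta>(2) by auto
    ultimately show ?thesis
      unfolding associated_cocycle_def using \<sigma> \<beta>(1) by (intro exI[of _ \<gamma>] exI[of _ \<sigma>] exI[of _ \<beta>]) simp
  qed
  moreover have "\<gamma> \<in> cocycles sg brg s1 act1 3 \<and>
      cohomology_class sg brg s1 act1 3 \<gamma> =
        connecting_hom sg brg s1 act1 s2 act2 i p 2 (cohomology_class sg brg s3 act3 2 \<alpha>)"
    if \<alpha>: "defining_cocycle sg brg s3 act3 se bre j q \<alpha>"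
      and \<gamma>: "associated_cocycle sg brg s2 se bre i (j \<circ> p) q (\<lambda>e. act2 (q e)) \<gamma>" for \<alpha> \<gamma>
  proof -
    obtain \<rho> \<beta> where \<rho>: "Vector_Spaces.linear sg se \<rho>" "\<And>x. q (\<rho> x) = x"
      and \<beta>: "\<beta> \<in> cochains sg s2 2"
        "\<And>x y. j ((p \<circ> \<beta>) [x, y]) = bre (\<rho> x) (\<rho> y) - \<rho> (brg x y)"
      and i\<gamma>: "i \<circ> \<gamma> = ce_d brg s2 act2 2 \<beta>"
      using \<gamma> unfolding associated_cocycle_def by auto
    obtain \<sigma> where \<sigma>: "Vector_Spaces.linear sg se \<sigma>" "\<And>x. q (\<sigma> x) = x"
      "\<And>x y. j (\<alpha> [x, y]) = bre (\<sigma> x) (\<sigma> y) - \<sigma> (brg x y)"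
      using B.defining_cocycle_section[OF \<alpha>] by blast
    have "\<alpha> \<in> cocycles sg brg s3 act3 2"
      using \<alpha> by (simp add: defining_cocycle_def)
    \<comment> \<open>Both cocycles are defects of sections of the same extension,
      \<open>\<sigma>\<close> from the equivalence and \<open>\<rho>\<close> from the crossed
      module.\<close>
    then have "(\<alpha>, p \<circ> \<beta>) \<in> cohomologous sg brg s3 act3 2"
      using B.section_cochains_cohomologous[OF \<sigma>(1,2) \<rho>(1,2) _ \<sigma>(3) _ \<beta>(2)]
        A.image_cocycle[OF \<beta>(1) i\<gamma>] by blast
    then show ?thesis
      using A.pullback_cocycle[OF \<beta>(1) i\<gamma>] A.connecting_hom_eq[OF \<beta>(1) i\<gamma>] by simp
  qed
  ultimately show ?thesis
    using yoneda_crossed_module[OF A B] B.section_defining_cocycle[OF \<sigma> \<alpha>] by blast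
qed

end
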